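(* For every integer $n\geq 4$ there is a tree $B_n$ with $\beta(B_n)=2$ and $$n=\psi(B_n)\leq \beta(B_n\,\square\,B_n)\leq n+1.$$
   Context: $d(v,w)$ denotes shortest-path distance. A vertex $x$ resolves $v,w$ if $d(v,x)\neq d(w,x)$; a set resolves a graph if every pair of distinct vertices is resolved by some vertex of the set; $\beta(G)$ is the minimum size of a resolving set. For $G\neq K_1$, vertices $v,w$ are doubly resolved by $x,y$ if $d(v,x)-d(w,x)\neq d(v,y)-d(w,y)$; a set is doubly resolving if every pair of distinct vertices is doubly resolved by two vertices of the set; $\psi(G)$ is the minimum size of a doubly resolving set. The cartesian product $G\,\square\,H$ has vertex set $V(G)\times V(H)$, with $(a,v)\sim(b,w)$ iff ($a=b$ and $vw\in E(H)$) or ($v=w$ and $ab\in E(G)$). *)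

theory Defs
  imports "Graph_Theory.Graph_Theory"
begin

text \<open>
  A finite simple undirected graph is a \<^locale>\<open>pair_graph\<close>: a finite vertex set with a symmetric,
  irreflexive set of arcs, each edge being represented by its two orientations.
\<close>

text \<open>
  The library constant \<^const>\<open>tree\<close> is not usable for undirected graphs: in a symmetric digraph,
  going along an edge and back is a cycle of length 2. Since there are no loops or parallel arcs,
  the cycles of the undirected graph are the cycles of length at least 3. Trees are nonempty,
  because \<^const>\<open>connected\<close> requires a vertex.
\<close>
definition is_tree :: "'a pair_pre_digraph \<Rightarrow> bool" where
  "is_tree G \<longleftrightarrow> pair_graph G \<and> connected (with_proj G) \<and>
     \<not> (\<exists>p. pre_digraph.cycle (with_proj G) p \<and> length p \<ge> 3)"

definition distance :: "'a pair_pre_digraph \<Rightarrow> 'a \<Rightarrow> 'a \<Rightarrow> ereal" where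
  "distance G u v = wf_digraph.\<mu> (with_proj G) (\<lambda>_. 1) u v"

definition resolves :: "'a pair_pre_digraph \<Rightarrow> 'a \<Rightarrow> 'a \<Rightarrow> 'a \<Rightarrow> bool" where
  "resolves G x v w \<longleftrightarrow> distance G v x \<noteq> distance G w x"

definition resolving_set :: "'a pair_pre_digraph \<Rightarrow> 'a set \<Rightarrow> bool" where
  "resolving_set G S \<longleftrightarrow> S \<subseteq> pverts G \<and>
     (\<forall>v\<in>pverts G. \<forall>w\<in>pverts G. v \<noteq> w \<longrightarrow> (\<exists>x\<in>S. resolves G x v w))"

text \<open>
  Only meaningful for connected graphs, where all distances are finite and the subtraction of
  extended reals is the ordinary one.
\<close>
definition doubly_resolves :: "'a pair_pre_digraph \<Rightarrow> 'a \<Rightarrow> 'a \<Rightarrow> 'a \<Rightarrow> 'a \<Rightarrow> bool" where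
  "doubly_resolves G x y v w \<longleftrightarrow>
     distance G v x - distance G w x \<noteq> distance G v y - distance G w y"

definition doubly_resolving_set :: "'a pair_pre_digraph \<Rightarrow> 'a set \<Rightarrow> bool" where
  "doubly_resolving_set G S \<longleftrightarrow> S \<subseteq> pverts G \<and>
     (\<forall>v\<in>pverts G. \<forall>w\<in>pverts G. v \<noteq> w \<longrightarrow> (\<exists>x\<in>S. \<exists>y\<in>S. doubly_resolves G x y v w))"

text \<open>
  Both minima exist for the intended arguments: the whole vertex set of a finite connected graph
  is resolving, and it is doubly resolving if the graph has at least two vertices.
\<close>
definition metric_dim :: "'a pair_pre_digraph \<Rightarrow> nat" (\<open>\<beta>\<close>) where
  "\<beta> G = (LEAST k. \<exists>S. resolving_set G S \<and> card S = k)"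

definition doubly_resolving_num :: "'a pair_pre_digraph \<Rightarrow> nat" (\<open>\<psi>\<close>) where
  "\<psi> G = (LEAST k. \<exists>S. doubly_resolving_set G S \<and> card S = k)"

definition cart_prod ::
  "'a pair_pre_digraph \<Rightarrow> 'b pair_pre_digraph \<Rightarrow> ('a \<times> 'b) pair_pre_digraph" (infixl \<open>\<box>\<close> 70)
where
  "G \<box> H = \<lparr> pverts = pverts G \<times> pverts H,
     parcs = {((a, v), (b, w)) | a v b w.
       (a = b \<and> a \<in> pverts G \<and> (v, w) \<in> parcs H) \<or>
       (v = w \<and> v \<in> pverts H \<and> (a, b) \<in> parcs G)} \<rparr>"

lemma pair_graph_cart_prod:
  assumes "pair_graph G" and "pair_graph H"
  shows "pair_graph (G \<box> H)"
proof -
  interpret G: pair_graph G by fact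
  interpret H: pair_graph H by fact
  have sub: "parcs (G \<box> H) \<subseteq> (pverts G \<times> pverts H) \<times> (pverts G \<times> pverts H)"
    by (auto simp: cart_prod_def dest: G.in_arcsD1 G.in_arcsD2 H.in_arcsD1 H.in_arcsD2)
  have fin: "finite (pverts G \<times> pverts H)"
    by simp
  have symG: "(a, b) \<in> parcs G \<Longrightarrow> (b, a) \<in> parcs G" for a b
    using G.pair_sym_arcs by (auto simp: symmetric_def sym_def)
  have symH: "(a, b) \<in> parcs H \<Longrightarrow> (b, a) \<in> parcs H" for a b
    using H.pair_sym_arcs by (auto simp: symmetric_def sym_def)
  show ?thesis
  proof
    show "symmetric (with_proj (G \<box> H))"
      unfolding symmetric_def by (auto simp: cart_prod_def sym_def intro: symG symH)
    show "finite (parcs (G \<box> H))"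
      using sub fin by (meson finite_SigmaI finite_subset)
    show "finite (pverts (G \<box> H))"
      using fin by (simp add: cart_prod_def)
  next
    fix e assume e: "e \<in> parcs (G \<box> H)"
    then show "fst e \<in> pverts (G \<box> H)" "snd e \<in> pverts (G \<box> H)"
      by (auto simp: cart_prod_def dest: G.in_arcsD1 G.in_arcsD2 H.in_arcsD1 H.in_arcsD2)
    from e show "fst e \<noteq> snd e"
      by (auto simp: cart_prod_def dest: G.pair_no_loops H.pair_no_loops)
  qed
qed

end

theory Submission
  imports Defs
begin

text \<open>
  The tree is the comb, a path on \<open>n\<close> vertices with a pendant edge at each vertex. In a tree the
  leaves form the smallest doubly resolving set, so here \<open>\<psi> = n\<close>, while the two extreme leaves
  already resolve the comb. If \<open>v\<close>, \<open>v'\<close> are leaves with neighbours \<open>u\<close>, \<open>u'\<close>, then \<open>(x, y)\<close>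
  resolves \<open>(v, u')\<close> and \<open>(u, v')\<close> in the product only if exactly one of \<open>x = v\<close>, \<open>y = v'\<close>
  holds. So a resolving set meets every row over a leaf or every column over a leaf, and has at
  least \<open>n\<close> elements. Conversely, if \<open>R\<close> resolves \<open>G\<close> and \<open>D\<close> doubly resolves \<open>H\<close>, then a copy of
  \<open>R\<close> and a copy of \<open>D\<close> sharing one vertex resolve \<open>G \<box> H\<close>.
\<close>

section \<open>Graphs with a known distance function\<close>

text \<open>The axioms characterise the distance of a connected graph, see \<open>distance_eq\<close>.\<close>

locale graph_dist = pair_graph G for G :: "'a pair_pre_digraph" +
  fixes d :: "'a \<Rightarrow> 'a \<Rightarrow> nat"
  assumes d_self: "v \<in> pverts G \<Longrightarrow> d v v = 0"
    and d_sym: "d u v = d v u"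
    and d_step: "u \<in> pverts G \<Longrightarrow> (a, b) \<in> parcs G \<Longrightarrow> d u b \<le> Suc (d u a)"
    and d_pred: "u \<in> pverts G \<Longrightarrow> v \<in> pverts G \<Longrightarrow> u \<noteq> v \<Longrightarrow>
      \<exists>a. (a, v) \<in> parcs G \<and> d u v = Suc (d u a)"
begin

text \<open>By \<open>d_step\<close>, each arc of a walk raises the distance from \<open>u\<close>
  by at most one. With \<open>a = u\<close> this bounds every walk length from below;
  \<open>ex_shortest_awalk\<close> attains the bound.\<close>

lemma awalk_length_ge:
  assumes "awalk a p b" "u \<in> pverts G"
  shows "d u b \<le> d u a + length p"
  using assms(1)
proof (induction p arbitrary: a)
  case (Cons e p)
  then have "e \<in> parcs G" "fst e = a" and w: "awalk (snd e) p b"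
    by (auto simp: awalk_Cons_iff)
  then have "d u (snd e) \<le> Suc (d u a)"
    using d_step[OF assms(2), of a "snd e"] by (metis prod.collapse)
  with Cons.IH[OF w] show ?case by simp
qed (simp add: awalk_Nil_iff)

text \<open>Descent along \<open>d_pred\<close>: from \<open>v\<close> step back to a neighbour that
  is one closer to \<open>u\<close>, until \<open>u\<close> is reached.\<close>

lemma ex_shortest_awalk:
  assumes "u \<in> pverts G" "v \<in> pverts G"
  shows "\<exists>p. awalk u p v \<and> length p = d u v"
  using assms(2)
proof (induction "d u v" arbitrary: v rule: less_induct)
  case less
  show ?case
  proof (cases "u = v")
    case True
    then show ?thesis using less.prems d_self by (auto simp: awalk_Nil_iff)
  next
    case False
    then obtain a where a: "(a, v) \<in> parcs G" "d u v = Suc (d u a)"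
      using d_pred[OF assms(1) less.prems] by blast
    then obtain p where "awalk u p a" "length p = d u a"
      using less.hyps[of a] in_arcsD1 by auto
    moreover have "awalk a [(a, v)] v"
      using a(1) by (simp add: awalk_simps in_arcsD1 in_arcsD2)
    ultimately have "awalk u (p @ [(a, v)]) v" "length (p @ [(a, v)]) = d u v"
      using a(2) by (auto simp del: awalk_append_iff intro: awalk_appendI)
    then show ?thesis by blast
  qed
qed

lemma distance_eq:
  assumes "u \<in> pverts G" "v \<in> pverts G"
  shows "distance G u v = ereal (real (d u v))"
proof -
  have cost: "awalk_cost (\<lambda>_. 1) p = real (length p)" for p :: "('a \<times> 'a) list"
    by (induction p) auto
  obtain p where p: "awalk u p v" "length p = d u v"
    using ex_shortest_awalk[OF assms] by blast
  have "d u v \<le> length q" if "awalk u q v" for q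
    using awalk_length_ge[OF that assms(1)] d_self[OF assms(1)] by simp
  then have "ereal (real (d u v)) \<le> \<mu> (\<lambda>_. 1) u v"
    unfolding \<mu>_def by (intro INF_greatest) (simp add: cost)
  moreover have "\<mu> (\<lambda>_. 1) u v \<le> ereal (real (d u v))"
    using min_cost_le_walk_cost[OF p(1), of "\<lambda>_. 1"] p(2) by (simp add: cost)
  ultimately show ?thesis
    unfolding distance_def by simp
qed

lemma connected:
  assumes "pverts G \<noteq> {}"
  shows "connected (with_proj G)"
proof -
  have "u \<rightarrow>\<^sup>*\<^bsub>with_proj G\<^esub> v" if "u \<in> pverts G" "v \<in> pverts G" for u v
    using ex_shortest_awalk[OF that] reachable_awalk by blast
  then show ?thesis
    using assms reachable_mk_symmetricI
    by (auto simp: connected_def strongly_connected_def mk_symmetric_def)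
qed

lemma resolves_iff:
  assumes "x \<in> pverts G" "v \<in> pverts G" "w \<in> pverts G"
  shows "resolves G x v w \<longleftrightarrow> d v x \<noteq> d w x"
  using assms by (simp add: resolves_def distance_eq)

lemma doubly_resolves_iff:
  assumes "x \<in> pverts G" "y \<in> pverts G" "v \<in> pverts G" "w \<in> pverts G"
  shows "doubly_resolves G x y v w \<longleftrightarrow>
    int (d v x) - int (d w x) \<noteq> int (d v y) - int (d w y)"
proof -
  have "real (d v x) - real (d w x) = real (d v y) - real (d w y) \<longleftrightarrow>
    int (d v x) - int (d w x) = int (d v y) - int (d w y)" by linarith
  with assms show ?thesis by (simp add: doubly_resolves_def distance_eq)
qed

section \<open>Leaves and doubly resolving sets\<close>

definition leaves :: "'a set" where
  "leaves = {v \<in> pverts G. \<exists>u. {w. (v, w) \<in> parcs G} = {u}}"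

text \<open>A shortest path from \<open>x\<close> to \<open>v\<close> must enter \<open>v\<close>
  through its only neighbour \<open>u\<close>, so \<open>d_pred\<close> at \<open>v\<close> can
  yield nothing but \<open>u\<close>.\<close>

lemma leafE:
  assumes "v \<in> leaves"
  obtains u where "u \<in> pverts G" "u \<noteq> v" "d u v = 1"
    "\<And>x. x \<in> pverts G \<Longrightarrow> x \<noteq> v \<Longrightarrow> d v x = Suc (d u x)"
proof -
  from assms obtain u where v: "v \<in> pverts G" and u: "{w. (v, w) \<in> parcs G} = {u}"
    unfolding leaves_def by blast
  then have arc: "(v, u) \<in> parcs G" by blast
  have *: "d v x = Suc (d u x)" if x: "x \<in> pverts G" "x \<noteq> v" for x
  proof -
    obtain a where "(a, v) \<in> parcs G" "d x v = Suc (d x a)"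
      using d_pred[OF x(1) v x(2)] by blast
    moreover from this have "a = u" using arcs_symmetric u by blast
    ultimately show ?thesis by (simp add: d_sym)
  qed
  have uV: "u \<in> pverts G" and uv: "u \<noteq> v" using arc in_arcsD2 no_loops' by auto
  moreover have "d u v = 1" using *[OF uV uv] d_self[OF uV] d_sym by simp
  ultimately show thesis using * that by blast
qed

text \<open>For a leaf \<open>v\<close> with neighbour \<open>u\<close>, the difference
  \<open>d v x - d u x\<close> is 1 at every vertex \<open>x\<close> other than \<open>v\<close>.
  Two vertices can doubly resolve \<open>v\<close> and \<open>u\<close> only if one of them is
  \<open>v\<close>.\<close>

lemma leaves_subset_doubly_resolving_set:
  assumes "doubly_resolving_set G S"
  shows "leaves \<subseteq> S"
proof
  fix v assume v: "v \<in> leaves"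
  then obtain u where u: "u \<in> pverts G" "u \<noteq> v"
    and du: "\<And>x. x \<in> pverts G \<Longrightarrow> x \<noteq> v \<Longrightarrow> d v x = Suc (d u x)"
    by (rule leafE) blast
  have vV: "v \<in> pverts G" using v by (simp add: leaves_def)
  then obtain x y where "x \<in> S" "y \<in> S" "doubly_resolves G x y v u"
    using assms u unfolding doubly_resolving_set_def by metis
  moreover from this have "x \<in> pverts G" "y \<in> pverts G"
    using assms by (auto simp: doubly_resolving_set_def)
  ultimately show "v \<in> S"
    using du u(1) vV by (cases "x = v"; cases "y = v") (auto simp: doubly_resolves_iff)
qed

end

lemma graph_dist_cart_prod:
  assumes "graph_dist G d" "graph_dist H e"
  shows "graph_dist (G \<box> H) (\<lambda>p q. d (fst p) (fst q) + e (snd p) (snd q))"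
proof -
  interpret G: graph_dist G d by fact
  interpret H: graph_dist H e by fact
  interpret P: pair_graph "G \<box> H"
    by (rule pair_graph_cart_prod) unfold_locales
  show ?thesis
  proof
    fix p q assume pq: "p \<in> pverts (G \<box> H)" "q \<in> pverts (G \<box> H)" "p \<noteq> q"
    obtain a v b w where [simp]: "p = (a, v)" "q = (b, w)" by (metis surj_pair)
    from pq have V: "a \<in> pverts G" "b \<in> pverts G" "v \<in> pverts H" "w \<in> pverts H"
      by (auto simp: cart_prod_def)
    show "\<exists>r. (r, q) \<in> parcs (G \<box> H) \<and> d (fst p) (fst q) + e (snd p) (snd q) =
      Suc (d (fst p) (fst r) + e (snd p) (snd r))"
    \<comment> \<open>A shortest path may correct one coordinate at a time: the second if the first
      ones agree, otherwise the first.\<close>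
    proof (cases "a = b")
      case True
      then obtain z where "(z, w) \<in> parcs H" "e v w = Suc (e v z)"
        using H.d_pred[of v w] pq(3) V by auto
      then show ?thesis
        using V True by (intro exI[of _ "(b, z)"]) (auto simp: cart_prod_def)
    next
      case False
      then obtain z where "(z, b) \<in> parcs G" "d a b = Suc (d a z)"
        using G.d_pred[of a b] V by auto
      then show ?thesis
        using V by (intro exI[of _ "(z, w)"]) (auto simp: cart_prod_def)
    qed
  qed (auto simp: cart_prod_def G.d_self H.d_self G.d_sym H.d_sym dest: G.d_step H.d_step)
qed

section \<open>Bounds for the metric dimension of a product\<close>

lemma finite_resolving_set:
  assumes "pair_graph G" "resolving_set G S"
  shows "finite S"
proof -
  interpret pair_graph G by fact
  from assms(2) have "S \<subseteq> pverts G" by (simp add: resolving_set_def)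
  then show ?thesis by (rule finite_subset) (rule pair_finite_verts)
qed

lemma metric_dim_le: "resolving_set G S \<Longrightarrow> \<beta> G \<le> card S"
  unfolding metric_dim_def by (rule Least_le) blast

text \<open>The first assumption guarantees that the \<open>LEAST\<close> in
  \<open>metric_dim_def\<close> is attained.\<close>

lemma metric_dim_ge:
  assumes "resolving_set G S" "\<And>T. resolving_set G T \<Longrightarrow> k \<le> card T"
  shows "k \<le> \<beta> G"
proof -
  have "\<exists>T. resolving_set G T \<and> card T = \<beta> G"
    unfolding metric_dim_def by (rule LeastI_ex) (use assms(1) in blast)
  with assms(2) show ?thesis by metis
qed

lemma min_card_leaves_le_card_resolving_set:
  assumes "graph_dist G d" "graph_dist H e" and S: "resolving_set (G \<box> H) S"
  shows "min (card (graph_dist.leaves G)) (card (graph_dist.leaves H)) \<le> card S"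
proof -
  interpret G: graph_dist G d by fact
  interpret H: graph_dist H e by fact
  interpret P: graph_dist "G \<box> H" "\<lambda>p q. d (fst p) (fst q) + e (snd p) (snd q)"
    by (rule graph_dist_cart_prod) fact+
  have fin: "finite S"
    using finite_resolving_set[OF P.pair_graph S] .
  have main: "\<exists>(x, y)\<in>S. (x = v) \<noteq> (y = v')" if v: "v \<in> G.leaves" and v': "v' \<in> H.leaves" for v v'
  proof -
    from v obtain u where u: "u \<in> pverts G" "u \<noteq> v" "d u v = 1"
      "\<And>x. x \<in> pverts G \<Longrightarrow> x \<noteq> v \<Longrightarrow> d v x = Suc (d u x)"
      by (rule G.leafE) blast
    from v' obtain u' where u': "u' \<in> pverts H" "u' \<noteq> v'" "e u' v' = 1"
      "\<And>x. x \<in> pverts H \<Longrightarrow> x \<noteq> v' \<Longrightarrow> e v' x = Suc (e u' x)"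
      by (rule H.leafE) blast
    have V: "v \<in> pverts G" "v' \<in> pverts H"
      using v v' by (auto simp: G.leaves_def H.leaves_def)
    have "(v, u') \<in> pverts (G \<box> H)" "(u, v') \<in> pverts (G \<box> H)" "(v, u') \<noteq> (u, v')"
      using V u u' by (auto simp: cart_prod_def)
    then obtain x y where xy: "(x, y) \<in> S" "resolves (G \<box> H) (x, y) (v, u') (u, v')"
      using S unfolding resolving_set_def by (metis surj_pair)
    moreover have "x \<in> pverts G" "y \<in> pverts H" "(x, y) \<in> pverts (G \<box> H)"
      using xy(1) S by (auto simp: resolving_set_def cart_prod_def)
    ultimately have ne: "d v x + e u' y \<noteq> d u x + e v' y"
      using P.resolves_iff[of "(x, y)" "(v, u')" "(u, v')"] V u u' by (auto simp: cart_prod_def)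
    \<comment> \<open>If neither equality holds, both sides of \<open>ne\<close> equal
      \<open>d u x + e u' y + 1\<close>; if both hold, both sides equal 1.\<close>
    have "(x = v) \<noteq> (y = v')"
      using ne u u' V \<open>x \<in> pverts G\<close> \<open>y \<in> pverts H\<close> G.d_self H.d_self
      by (cases "x = v"; cases "y = v'") auto
    with xy(1) show ?thesis by blast
  qed
  show ?thesis
  proof (cases "G.leaves \<subseteq> fst ` S")
    case True
    then have "card G.leaves \<le> card S"
      using fin by (meson card_image_le card_mono finite_imageI le_trans)
    then show ?thesis by simp
  next
    case False
    then obtain v where "v \<in> G.leaves" "v \<notin> fst ` S" by blast
    \<comment> \<open>No pair in \<open>S\<close> has first component \<open>v\<close>, so for each
      leaf \<open>v'\<close> the pair given by \<open>main\<close> must have second component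
      \<open>v'\<close>.\<close>
    then have "H.leaves \<subseteq> snd ` S" using main by force
    then have "card H.leaves \<le> card S"
      using fin by (meson card_image_le card_mono finite_imageI le_trans)
    then show ?thesis by simp
  qed
qed

text \<open>Let \<open>(a, v)\<close> and \<open>(b, w)\<close> be distinct. If
  \<open>v = w\<close>, the copy of \<open>R\<close> separates them. Otherwise take
  \<open>y\<close>, \<open>y'\<close> in \<open>D\<close> doubly resolving \<open>v\<close>,
  \<open>w\<close>: if neither \<open>(r, y)\<close> nor \<open>(r, y')\<close> resolved the pair,
  \<open>e v y - e w y\<close> and \<open>e v y' - e w y'\<close> would both equal
  \<open>d b r - d a r\<close>.\<close>

lemma resolving_set_cart_prod:
  assumes "graph_dist G d" "graph_dist H e"
    and R: "resolving_set G R" "r \<in> R" and D: "doubly_resolving_set H D" "s \<in> D"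
  shows "resolving_set (G \<box> H) (R \<times> {s} \<union> {r} \<times> D)"
proof -
  interpret G: graph_dist G d by fact
  interpret H: graph_dist H e by fact
  interpret P: graph_dist "G \<box> H" "\<lambda>p q. d (fst p) (fst q) + e (snd p) (snd q)"
    by (rule graph_dist_cart_prod) fact+
  have RV: "R \<subseteq> pverts G" and DV: "D \<subseteq> pverts H"
    using R D by (auto simp: resolving_set_def doubly_resolving_set_def)
  have sub: "R \<times> {s} \<union> {r} \<times> D \<subseteq> pverts (G \<box> H)"
    using RV DV R D by (auto simp: cart_prod_def)
  have "\<exists>z\<in>R \<times> {s} \<union> {r} \<times> D. resolves (G \<box> H) z p q"
    if pq: "p \<in> pverts (G \<box> H)" "q \<in> pverts (G \<box> H)" "p \<noteq> q" for p q
  proof -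
    obtain a v b w where [simp]: "p = (a, v)" "q = (b, w)" by (metis surj_pair)
    from pq have V: "a \<in> pverts G" "b \<in> pverts G" "v \<in> pverts H" "w \<in> pverts H"
      by (auto simp: cart_prod_def)
    have res: "resolves (G \<box> H) (x, y) p q \<longleftrightarrow> d a x + e v y \<noteq> d b x + e w y"
      if "(x, y) \<in> R \<times> {s} \<union> {r} \<times> D" for x y
      using P.resolves_iff[of "(x, y)" p q] that sub pq by auto
    show ?thesis
    proof (cases "v = w")
      case True
      then obtain x where "x \<in> R" "resolves G x a b"
        using R V pq(3) unfolding resolving_set_def by fastforce
      then have "d a x \<noteq> d b x" using G.resolves_iff RV V by auto
      then have "resolves (G \<box> H) (x, s) p q"
        using res[of x s] True \<open>x \<in> R\<close> by simp
      then show ?thesis using \<open>x \<in> R\<close> by blast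
    next
      case False
      then obtain y y' where y: "y \<in> D" "y' \<in> D" "doubly_resolves H y y' v w"
        using D V unfolding doubly_resolving_set_def by metis
      then have "int (e v y) - int (e w y) \<noteq> int (e v y') - int (e w y')"
        using H.doubly_resolves_iff DV V by blast
      then have "d a r + e v y \<noteq> d b r + e w y \<or> d a r + e v y' \<noteq> d b r + e w y'"
        by linarith
      then show ?thesis using res y by blast
    qed
  qed
  with sub show ?thesis unfolding resolving_set_def by blast
qed

section \<open>Cycles\<close>

text \<open>The largest vertex of a cycle of length at least 3 has two smaller neighbours.\<close>

lemma no_long_cycle:
  fixes G :: "'a :: linorder pair_pre_digraph"
  assumes "pair_graph G"
    and uniq: "\<And>v a b. (a, v) \<in> parcs G \<Longrightarrow> (b, v) \<in> parcs G \<Longrightarrow> a < v \<Longrightarrow> b < v \<Longrightarrow> a = b"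
  shows "\<not> (\<exists>p. pre_digraph.cycle (with_proj G) p \<and> length p \<ge> 3)"
proof
  interpret pair_graph G by fact
  assume "\<exists>p. cycle p \<and> length p \<ge> 3"
  then obtain u p where walk: "awalk u p u" and dist: "distinct (tl (awalk_verts u p))"
    and len: "length p \<ge> 3"
    unfolding cycle_def by blast
  define k where "k = length p"
  have k: "k \<ge> 3" "p \<noteq> []" using len k_def by auto
  have cas: "cas u p u" and arcs: "set p \<subseteq> parcs G" using walk by (auto simp: awalk_def)
  have verts: "awalk_verts u p = fst (hd p) # map snd p"
    using awalk_verts_conv'[OF cas] k by simp
  have verts': "awalk_verts u p = map fst p @ [snd (last p)]"
    using k by (simp add: awalk_verts_conv)
  have inj: "i = j" if "snd (p ! i) = snd (p ! j)" "i < k" "j < k" for i j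
    using dist that verts by (auto simp: k_def distinct_conv_nth)
  have closed: "snd (last p) = fst (hd p)"
    using awlast_if_cas[OF cas] cas cas_simp[OF k(2)] verts' by simp
  \<comment> \<open>Indices are read modulo \<open>k\<close>, so that the maximum may also sit where
    the walk closes up.\<close>
  have next_arc: "fst (p ! (Suc i mod k)) = snd (p ! i)" if "i < k" for i
  proof (cases "Suc i = k")
    case True
    then have "p ! i = last p" using k by (simp add: last_conv_nth k_def[symmetric] flip: True)
    then show ?thesis using True closed k by (simp add: hd_conv_nth)
  next
    case False
    then have "Suc i < k" using that by simp
    then have "awalk_verts u p ! Suc i = fst (p ! Suc i)"
      unfolding verts' by (simp add: nth_append k_def)
    moreover have "awalk_verts u p ! Suc i = snd (p ! i)"
      unfolding verts using that by (simp add: k_def)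
    ultimately show ?thesis using \<open>Suc i < k\<close> by simp
  qed
  have fin: "finite (snd ` set p)" and ne: "snd ` set p \<noteq> {}" using k by auto
  obtain e where e: "e \<in> set p" "snd e = Max (snd ` set p)"
    using Max_in[OF fin ne] by auto
  obtain i where i: "i < k" "p ! i = e" using e(1) by (metis in_set_conv_nth k_def)
  define m where "m = snd (p ! i)"
  have le: "snd (p ! j) \<le> m" if "j < k" for j
    using that Max_ge[OF fin] e(2) i by (auto simp: m_def k_def)
  have arc: "p ! j \<in> parcs G" if "j < k" for j using that arcs by (auto simp: k_def)
  \<comment> \<open>The cyclic predecessor and successor of \<open>i\<close>; adding
    \<open>k\<close> first avoids truncation at \<open>i = 0\<close>. They differ because
    \<open>k\<close> is at least 3.\<close>
  define h where "h = (i + k - 1) mod k"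
  define j where "j = Suc i mod k"
  have hj: "h < k" "j < k" "Suc h mod k = i" "h \<noteq> j"
    using i(1) k by (auto simp: h_def j_def mod_Suc mod_if)
  have in1: "(snd (p ! h), m) \<in> parcs G"
    using arc[OF i(1)] next_arc[OF hj(1)] hj(3) by (metis m_def prod.collapse)
  have "(m, snd (p ! j)) \<in> parcs G"
    using arc[OF hj(2)] next_arc[OF i(1)] by (metis m_def j_def prod.collapse)
  then have in2: "(snd (p ! j), m) \<in> parcs G" by (rule arcs_symmetric)
  have "snd (p ! h) < m" "snd (p ! j) < m"
    using le hj in1 in2 no_loops' by (metis order_le_less)+
  then have "snd (p ! h) = snd (p ! j)" using uniq in1 in2 by blast
  with inj hj show False by blast
qed

section \<open>The comb\<close>

text \<open>The path vertices are \<open>0, 2, \<dots>, 2 n - 2\<close>, and the pendant vertex at \<open>2 i\<close> is \<open>2 i + 1\<close>.\<close>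

definition comb :: "nat \<Rightarrow> nat pair_pre_digraph" where
  "comb n = \<lparr> pverts = {..<2 * n},
     parcs = {(x, y). x < 2 * n \<and> y < 2 * n \<and>
       ((even x \<and> (y = x + 1 \<or> y = x + 2)) \<or> (even y \<and> (x = y + 1 \<or> x = y + 2)))} \<rparr>"

text \<open>\<open>x div 2\<close> is the position on the path and \<open>x mod 2\<close> the height
  above it. The two truncated differences add up to the absolute difference of the
  positions.\<close>

definition comb_dist :: "nat \<Rightarrow> nat \<Rightarrow> nat" where
  "comb_dist x y = (if x = y then 0 else if x div 2 = y div 2 then 1
     else (x div 2 - y div 2) + (y div 2 - x div 2) + x mod 2 + y mod 2)"

lemma comb_vertexE:
  obtains i e where "x = 2 * i + e" "e = 0 \<or> e = (1 :: nat)"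
  using that[of "x div 2" "x mod 2"] by fastforce

lemma comb_dist_eq:
  assumes "e = 0 \<or> e = 1" "f = 0 \<or> f = 1"
  shows "comb_dist (2 * i + e) (2 * j + f) =
    (if i = j then if e = f then 0 else 1 else (i - j) + (j - i) + e + f)"
proof -
  have "2 * i + e = 2 * j + f \<longleftrightarrow> i = j \<and> e = f" using assms by presburger
  moreover have "(2 * i + e) div 2 = i" "(2 * i + e) mod 2 = e"
    "(2 * j + f) div 2 = j" "(2 * j + f) mod 2 = f" using assms by auto
  ultimately show ?thesis unfolding comb_dist_def by simp
qed

lemma pair_graph_comb: "pair_graph (comb n)"
proof
  have sub: "parcs (comb n) \<subseteq> {..<2 * n} \<times> {..<2 * n}" by (auto simp: comb_def)
  then show "finite (parcs (comb n))" by (rule finite_subset) simp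
qed (auto simp: comb_def symmetric_def sym_def)

lemma graph_dist_comb: "graph_dist (comb n) comb_dist"
proof -
  interpret pair_graph "comb n" by (rule pair_graph_comb)
  show ?thesis
  proof
    show "comb_dist v v = 0" for v by (simp add: comb_dist_def)
    show "comb_dist u v = comb_dist v u" for u v by (simp add: comb_dist_def)
  next
    fix u a b :: nat assume ab: "(a, b) \<in> parcs (comb n)"
    obtain i e where u: "u = 2 * i + e" "e = 0 \<or> e = 1" by (rule comb_vertexE)
    obtain j f where a: "a = 2 * j + f" "f = 0 \<or> f = 1" by (rule comb_vertexE)
    obtain k g where b: "b = 2 * k + g" "g = 0 \<or> g = 1" by (rule comb_vertexE)
    have "j = k \<or> f = 0 \<and> g = 0 \<and> (k = Suc j \<or> j = Suc k)"
      using ab a(2) b(2) unfolding a(1) b(1) by (auto simp: comb_def; presburger)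
    then show "comb_dist u b \<le> Suc (comb_dist u a)"
      using u(2) a(2) b(2)
      unfolding u(1) a(1) b(1) comb_dist_eq[OF u(2) a(2)] comb_dist_eq[OF u(2) b(2)]
      by auto
  next
    fix u v :: nat assume uv: "u \<in> pverts (comb n)" "v \<in> pverts (comb n)" "u \<noteq> v"
    obtain i e where u: "u = 2 * i + e" "e = 0 \<or> e = 1" by (rule comb_vertexE)
    obtain k g where v: "v = 2 * k + g" "g = 0 \<or> g = 1" by (rule comb_vertexE)
    \<comment> \<open>\<open>2 * j + f\<close> is the neighbour of \<open>v\<close> towards
      \<open>u\<close>: a leaf steps down to the path, a path vertex steps along the path towards
      position \<open>i\<close>, or up to its own leaf when that leaf is \<open>u\<close>.\<close>
    define j where "j = (if g = 1 \<or> i = k then k else if i < k then k - 1 else k + 1)"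
    define f where "f = (if g = 0 \<and> i = k then 1 else 0 :: nat)"
    have f: "f = 0 \<or> f = 1" by (simp add: f_def)
    have "(2 * j + f, v) \<in> parcs (comb n)"
      using uv u(2) v(2) unfolding u(1) v(1) j_def f_def by (auto simp: comb_def)
    moreover have "comb_dist u v = Suc (comb_dist u (2 * j + f))"
    proof -
      have "\<not> (i = k \<and> e = g)" using uv(3) u(1) v(1) by blast
      then show ?thesis
        unfolding u(1) v(1) comb_dist_eq[OF u(2) v(2)] comb_dist_eq[OF u(2) f]
        using u(2) v(2) by (cases i k rule: linorder_cases) (auto simp: j_def f_def)
    qed
    ultimately show "\<exists>a. (a, v) \<in> parcs (comb n) \<and> comb_dist u v = Suc (comb_dist u a)"
      by blast
  qed
qed

lemma is_tree_comb:
  assumes "n > 0"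
  shows "is_tree (comb n)"
proof -
  interpret graph_dist "comb n" comb_dist by (rule graph_dist_comb)
  have "0 \<in> pverts (comb n)" using assms by (simp add: comb_def)
  moreover have "\<not> (\<exists>p. pre_digraph.cycle (with_proj (comb n)) p \<and> length p \<ge> 3)"
    \<comment> \<open>The only smaller neighbour of a leaf \<open>2 * i + 1\<close> is
      \<open>2 * i\<close>, and that of a path vertex \<open>2 * i\<close> can only be
      \<open>2 * i - 2\<close>.\<close>
    by (rule no_long_cycle[OF pair_graph_comb]) (auto simp: comb_def)
  ultimately show ?thesis
    unfolding is_tree_def using pair_graph_comb connected by blast
qed

section \<open>The doubly resolving number of the comb\<close>

lemma comb_leaves: "(\<lambda>i. 2 * i + 1) ` {..<n} \<subseteq> graph_dist.leaves (comb n)"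
proof
  interpret graph_dist "comb n" comb_dist by (rule graph_dist_comb)
  fix v assume "v \<in> (\<lambda>i. 2 * i + 1) ` {..<n}"
  then obtain i where i: "i < n" "v = 2 * i + 1" by blast
  then have "{w. (v, w) \<in> parcs (comb n)} = {2 * i}"
    by (auto simp: comb_def) presburger
  moreover have "v \<in> pverts (comb n)" using i by (simp add: comb_def)
  ultimately show "v \<in> leaves" unfolding leaves_def by blast
qed

lemma card_comb_leaves_ge: "n \<le> card (graph_dist.leaves (comb n))"
proof -
  interpret graph_dist "comb n" comb_dist by (rule graph_dist_comb)
  have "finite leaves" by (simp add: leaves_def)
  then have "card ((\<lambda>i. 2 * i + 1) ` {..<n}) \<le> card leaves"
    by (rule card_mono) (rule comb_leaves)
  then show ?thesis by (simp add: card_image inj_on_def)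
qed

lemma doubly_resolving_set_comb:
  assumes "n \<ge> 2"
  shows "doubly_resolving_set (comb n) ((\<lambda>i. 2 * i + 1) ` {..<n})"
proof -
  interpret graph_dist "comb n" comb_dist by (rule graph_dist_comb)
  let ?L = "(\<lambda>i. 2 * i + 1) ` {..<n}"
  have sub: "?L \<subseteq> pverts (comb n)" by (auto simp: comb_def)
  have "\<exists>x\<in>?L. \<exists>y\<in>?L. doubly_resolves (comb n) x y v w"
    if vw: "v \<in> pverts (comb n)" "w \<in> pverts (comb n)" "v \<noteq> w" for v w
  proof -
    obtain i e where v: "v = 2 * i + e" "e = 0 \<or> e = 1" by (rule comb_vertexE)
    obtain k f where w: "w = 2 * k + f" "f = 0 \<or> f = 1" by (rule comb_vertexE)
    \<comment> \<open>The leaves at the positions of \<open>v\<close> and \<open>w\<close> give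
      differences of opposite sign. If the positions coincide, any other leaf does for the second
      one, and one exists since \<open>n \<ge> 2\<close>.\<close>
    define j where "j = (if k \<noteq> i then k else if i = 0 then 1 else 0)"
    have ij: "i < n" "j < n"
      using vw assms by (auto simp: comb_def j_def v(1) w(1))
    then have "2 * i + 1 \<in> ?L" "2 * j + 1 \<in> ?L" by auto
    moreover have "int (comb_dist v (2 * i + 1)) - int (comb_dist w (2 * i + 1))
        \<noteq> int (comb_dist v (2 * j + 1)) - int (comb_dist w (2 * j + 1))"
      using vw(3) v(2) w(2) unfolding v(1) w(1) comb_dist_eq[OF v(2) disjI2[OF refl]]
        comb_dist_eq[OF w(2) disjI2[OF refl]] by (auto simp: j_def)
    ultimately show ?thesis
      using doubly_resolves_iff sub vw by blast
  qed
  with sub show ?thesis unfolding doubly_resolving_set_def by blast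
qed

lemma doubly_resolving_num_comb:
  assumes "n \<ge> 2"
  shows "\<psi> (comb n) = n"
  unfolding doubly_resolving_num_def
proof (rule Least_equality)
  show "\<exists>S. doubly_resolving_set (comb n) S \<and> card S = n"
    using doubly_resolving_set_comb[OF assms] by (force simp: card_image inj_on_def)
next
  interpret graph_dist "comb n" comb_dist by (rule graph_dist_comb)
  fix k assume "\<exists>S. doubly_resolving_set (comb n) S \<and> card S = k"
  then obtain S where S: "doubly_resolving_set (comb n) S" "card S = k" by blast
  then have "finite S"
    unfolding doubly_resolving_set_def using finite_subset pair_finite_verts by blast
  then have "card leaves \<le> k"
    using leaves_subset_doubly_resolving_set[OF S(1)] S(2) card_mono by blast
  with card_comb_leaves_ge show "n \<le> k" by (rule le_trans)
qed

section \<open>The metric dimension of the comb\<close>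

lemma resolving_set_comb:
  assumes "n \<ge> 2"
  shows "resolving_set (comb n) {1, 2 * n - 1}"
proof -
  interpret graph_dist "comb n" comb_dist by (rule graph_dist_comb)
  have sub: "{1, 2 * n - 1} \<subseteq> pverts (comb n)" using assms by (auto simp: comb_def)
  have "comb_dist v 1 \<noteq> comb_dist w 1 \<or> comb_dist v (2 * n - 1) \<noteq> comb_dist w (2 * n - 1)"
    if "v < 2 * n" "w < 2 * n" "v \<noteq> w" for v w
  proof -
    obtain i e where v: "v = 2 * i + e" "e = 0 \<or> e = 1" by (rule comb_vertexE)
    obtain k f where w: "w = 2 * k + f" "f = 0 \<or> f = 1" by (rule comb_vertexE)
    have dist: "comb_dist (2 * m + g) 1 = (if m = 0 then 1 - g else m + g + 1)"
      "comb_dist (2 * m + g) (2 * n - 1) = (if m = n - 1 then 1 - g else n - m + g)"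
      if "m < n" "g = 0 \<or> g = 1" for m g
    proof -
      have "2 * n - 1 = 2 * (n - 1) + 1" using assms by simp
      then show "comb_dist (2 * m + g) (2 * n - 1) = (if m = n - 1 then 1 - g else n - m + g)"
        using that comb_dist_eq[of g 1 m "n - 1"] by auto
      show "comb_dist (2 * m + g) 1 = (if m = 0 then 1 - g else m + g + 1)"
        using that comb_dist_eq[of g 1 m 0] by auto
    qed
    have ik: "i < n" "k < n" using that v w by auto
    have "\<not> (i = k \<and> e = f)" using that(3) v(1) w(1) by blast
    \<comment> \<open>An end leaf is at distance at most 1 exactly from the vertices at its own
      position. Away from both ends the distances \<open>m + g + 1\<close> and
      \<open>n - m + g\<close> determine \<open>g\<close> by their sum and \<open>m\<close> by their
      difference; at an end, \<open>1 - g\<close> determines \<open>g\<close>.\<close>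
    moreover have False if eq:
      "(if i = 0 then 1 - e else i + e + 1) = (if k = 0 then 1 - f else k + f + 1)"
      "(if i = n - 1 then 1 - e else n - i + e) = (if k = n - 1 then 1 - f else n - k + f)"
      and ne: "\<not> (i = k \<and> e = f)"
    proof -
      have le: "e \<le> 1" "f \<le> 1" using v(2) w(2) by auto
      have "i = 0 \<longleftrightarrow> k = 0"
        using eq(1) by (cases "i = 0"; cases "k = 0") simp_all
      moreover have "i = n - 1 \<longleftrightarrow> k = n - 1"
        using eq(2) ik by (cases "i = n - 1"; cases "k = n - 1") simp_all
      ultimately show False
        using eq ne le ik by (cases "k = 0"; cases "k = n - 1") simp_all
    qed
    ultimately show ?thesis
      unfolding v(1) w(1) dist[OF ik(1) v(2)] dist[OF ik(2) w(2)] by blast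
  qed
  then have "\<exists>x\<in>{1, 2 * n - 1}. resolves (comb n) x v w"
    if "v \<in> pverts (comb n)" "w \<in> pverts (comb n)" "v \<noteq> w" for v w
    using that sub resolves_iff by (auto simp: comb_def)
  with sub show ?thesis unfolding resolving_set_def by blast
qed

lemma metric_dim_comb:
  assumes "n \<ge> 4"
  shows "\<beta> (comb n) = 2"
proof (rule antisym)
  have n: "n \<ge> 2" using assms by simp
  show "\<beta> (comb n) \<le> 2"
    using metric_dim_le[OF resolving_set_comb[OF n]] n by (simp add: card_insert_if)
  interpret graph_dist "comb n" comb_dist by (rule graph_dist_comb)
  show "2 \<le> \<beta> (comb n)"
  proof (rule metric_dim_ge[OF resolving_set_comb[OF n]], rule ccontr)
    fix S assume S: "resolving_set (comb n) S" and "\<not> 2 \<le> card S"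
    then have "card S \<le> Suc 0" by simp
    then have "S = {} \<or> (\<exists>x. S = {x})"
      using finite_resolving_set[OF pair_graph_comb S] card_le_Suc0_iff_eq by blast
    \<comment> \<open>Inclusion in a singleton also covers the empty set, with 0 as default.\<close>
    then have "\<exists>x<2 * n. S \<subseteq> {x}"
      using S assms by (auto simp: resolving_set_def comb_def intro: exI[of _ 0])
    then obtain x where x: "x < 2 * n" "S \<subseteq> {x}" by blast
    \<comment> \<open>Since \<open>n \<ge> 4\<close>, on one side of position \<open>i\<close> there are two further positions. The leaf at the
      first and the path vertex at the second are equally far from \<open>x\<close>.\<close>
    obtain i e where ie: "x = 2 * i + e" "e = 0 \<or> e = 1" by (rule comb_vertexE)
    define j where "j = (if i + 2 < n then i + 1 else i - 1)"
    define k where "k = (if i + 2 < n then i + 2 else i - 2)"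
    define v where "v = 2 * j + 1"
    define w where "w = 2 * k + 0"
    have jk: "j < n" "k < n" "i \<noteq> j" "i \<noteq> k" "(j - i) + (i - j) = 1" "(k - i) + (i - k) = 2"
      using x(1) assms by (auto simp: j_def k_def ie(1))
    have "v \<noteq> w" unfolding v_def w_def by presburger
    with jk have vw: "v \<in> pverts (comb n)" "w \<in> pverts (comb n)" "v \<noteq> w"
      by (auto simp: comb_def v_def w_def)
    have "comb_dist v x = comb_dist w x"
      unfolding v_def w_def ie(1) comb_dist_eq[OF disjI2[OF refl] ie(2)]
        comb_dist_eq[OF disjI1[OF refl] ie(2)] using jk by simp
    then have "\<not> resolves (comb n) x v w"
      using resolves_iff[OF _ vw(1,2)] x(1) by (simp add: comb_def)
    with S vw x(2) show False unfolding resolving_set_def by blast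
  qed
qed

theorem theorem9p3:
  fixes n :: nat
  assumes "n \<ge> 4"
  shows "\<exists>B :: nat pair_pre_digraph. is_tree B \<and> \<beta> B = 2 \<and>
    n = \<psi> B \<and> \<psi> B \<le> \<beta> (B \<box> B) \<and> \<beta> (B \<box> B) \<le> n + 1"
proof -
  have n: "n \<ge> 2" using assms by simp
  let ?R = "{1, 2 * n - 1}"
  let ?L = "(\<lambda>i. 2 * i + 1) ` {..<n}"
  let ?S = "?R \<times> {1} \<union> {1} \<times> ?L"
  have res: "resolving_set (comb n \<box> comb n) ?S"
  proof (rule resolving_set_cart_prod[OF graph_dist_comb graph_dist_comb])
    show "1 \<in> ?L" using n by (intro image_eqI[of _ _ 0]) auto
  qed (use resolving_set_comb[OF n] doubly_resolving_set_comb[OF n] in auto)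
  have "1 \<in> ?L" using n by (intro image_eqI[of _ _ 0]) auto
  \<comment> \<open>The shared vertex \<open>(1, 1)\<close> is counted once, so the copy of
    \<open>?R\<close> adds a single vertex to the \<open>n\<close> of the other copy.\<close>
  then have "?S = insert (2 * n - 1, 1) ({1} \<times> ?L)" by auto
  also have "card \<dots> \<le> Suc (card ({1 :: nat} \<times> ?L))"
    by (rule card_insert_le_m1) auto
  also have "card ({1 :: nat} \<times> ?L) = n"
    by (simp add: card_cartesian_product card_image inj_on_def)
  finally have "\<beta> (comb n \<box> comb n) \<le> n + 1"
    using metric_dim_le[OF res] by simp
  moreover have "n \<le> \<beta> (comb n \<box> comb n)"
  proof (rule metric_dim_ge[OF res])
    fix T assume "resolving_set (comb n \<box> comb n) T"
    from min_card_leaves_le_card_resolving_set[OF graph_dist_comb graph_dist_comb this]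
    show "n \<le> card T" using card_comb_leaves_ge[of n] by simp
  qed
  ultimately show ?thesis
    using is_tree_comb[of n] metric_dim_comb[OF assms] doubly_resolving_num_comb[OF n] assms
    by (intro exI[of _ "comb n"]) auto
qed

end
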